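(* Assume that $\sup_{u\in[0,T]}\sum_{k\in\mathbb Z} f(u-k\Delta)<\infty$. Let $a>0$ and $c>0$. For every $t\in(0,T]$, let $\theta_t\in\mathbb R$ be such that $\Lambda_t'(\theta_t)=a+ct$, where $\Lambda_t(\theta):=\log\mathbb E e^{\theta A(t)}$, and define the path $$\phi_t^*(u):=\frac{\mathbb E\bigl[A(u)e^{\theta_tA(t)}\bigr]}{\mathbb E\bigl[e^{\theta_tA(t)}\bigr]},\qquad u\in[0,T].$$ Then $$I_T(\phi_t^* )=I_A[0,t]\bigl(\phi_t^*(t)\bigr).$$
   Context: Fix $\Delta>0$ and $T>0$. Let $(T_k)_{k\in\mathbb Z}$ be i.i.d. real random variables with distribution function $F$ and probability density $f$. Put $A_k:=k\Delta+T_k$ for $k\in\mathbb Z$, and define the arrival counting process $A(t):=\sum_{k\in\mathbb Z}\mathbf 1_{\{0<A_k\le t\}}$, $t\in[0,T]$. $D([0,T])$ is the space of càdlàg functions $[0,T]\to\mathbb R$. For $\phi\in D([0,T])$ define $$I_T(\phi)=\sup_{m\ge1}\ \sup_{0<t_1<\cdots<t_m\le T}\ \sup_{\alpha\in\mathbb R^m}\Bigl\{\sum_{\ell=1}^m\alpha_\ell\phi(t_\ell)-\log\mathbb E\exp\Bigl(\sum_{\ell=1}^m\alpha_\ell A(t_\ell)\Bigr)\Bigr\}.$$ For $t\in(0,T]$ and $x\in\mathbb R$ define $I_A[0,t](x):=\inf\{I_T(\phi):\phi\in D([0,T]),\ \phi(t)=x\}$. The path $\phi_t^*$ is the mean path $\phi_t^*(u)=\mathbb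 E^{\theta_t}[A(u)]$ under the exponentially tilted measure $d\mathbb P^{\theta_t}/d\mathbb P=\exp(\theta_tA(t)-\Lambda_t(\theta_t))$. Here $c$ is the deterministic service rate and $a$ the overflow level of the workload. *)

theory Defs
  imports "HOL-Probability.Probability"
begin

definition arrival_time :: "real \<Rightarrow> (int \<Rightarrow> 'a \<Rightarrow> real) \<Rightarrow> int \<Rightarrow> 'a \<Rightarrow> real" where
  "arrival_time \<Delta> X k \<omega> = of_int k * \<Delta> + X k \<omega>"

text \<open>
  The real-valued \<^const>\<open>infsum\<close> is 0 when infinitely many arrivals fall into the interval
  \<open>(0, t]\<close>. If the arrival displacements have a density \<open>f\<close>, the expected number of arrivals in
  that interval is the integral over it of the sum of \<open>f (u - k\<Delta>)\<close> over all \<open>k\<close>, which is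
  finite, so this convention only concerns a null event.
\<close>

definition arrival_count :: "real \<Rightarrow> (int \<Rightarrow> 'a \<Rightarrow> real) \<Rightarrow> real \<Rightarrow> 'a \<Rightarrow> real" where
  "arrival_count \<Delta> X t \<omega> = (\<Sum>\<^sub>\<infinity>k::int. indicator {0<..t} (arrival_time \<Delta> X k \<omega>))"

text \<open>
  The logarithm of the expectation of \<open>exp Y\<close>. It is only applied to linear combinations of arrival
  counts. A count is a sum of independent indicators with summable success probabilities, so all
  its exponential moments are finite and the Bochner integral is the true expectation.
\<close>

definition log_mgf :: "'a measure \<Rightarrow> ('a \<Rightarrow> real) \<Rightarrow> real" where
  "log_mgf M Y = ln (\<integral>\<omega>. exp (Y \<omega>) \<partial>M)"

text \<open>
  The space \<open>D([0,T])\<close>. Its elements are represented by total functions whose values outside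
  \<open>[0,T]\<close> are unconstrained and never used below.
\<close>

definition cadlag_paths :: "real \<Rightarrow> (real \<Rightarrow> real) set" where
  "cadlag_paths T = {\<phi>. \<forall>u\<in>{0..T}.
     (\<phi> \<longlongrightarrow> \<phi> u) (at u within {u..T}) \<and> (\<exists>l. (\<phi> \<longlongrightarrow> l) (at u within {0..<u}))}"

definition path_rate ::
  "'a measure \<Rightarrow> real \<Rightarrow> (int \<Rightarrow> 'a \<Rightarrow> real) \<Rightarrow> real \<Rightarrow> (real \<Rightarrow> real) \<Rightarrow> ereal" where
  "path_rate M \<Delta> X T \<phi> =
    (SUP m\<in>{1::nat..}.
     SUP \<tau>\<in>{\<tau>::nat \<Rightarrow> real. strict_mono_on {1..m} \<tau> \<and> 0 < \<tau> 1 \<and> \<tau> m \<le> T}.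
     SUP \<alpha>::nat \<Rightarrow> real.
       ereal ((\<Sum>l=1..m. \<alpha> l * \<phi> (\<tau> l))
         - log_mgf M (\<lambda>\<omega>. \<Sum>l=1..m. \<alpha> l * arrival_count \<Delta> X (\<tau> l) \<omega>)))"

definition marginal_rate ::
  "'a measure \<Rightarrow> real \<Rightarrow> (int \<Rightarrow> 'a \<Rightarrow> real) \<Rightarrow> real \<Rightarrow> real \<Rightarrow> real \<Rightarrow> ereal" where
  "marginal_rate M \<Delta> X T t x =
    (INF \<phi>\<in>{\<phi> \<in> cadlag_paths T. \<phi> t = x}. path_rate M \<Delta> X T \<phi>)"

definition mean_path ::
  "'a measure \<Rightarrow> real \<Rightarrow> (int \<Rightarrow> 'a \<Rightarrow> real) \<Rightarrow> real \<Rightarrow> real \<Rightarrow> real \<Rightarrow> real" where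
  "mean_path M \<Delta> X t \<theta> u =
    (\<integral>\<omega>. arrival_count \<Delta> X u \<omega> * exp (\<theta> * arrival_count \<Delta> X t \<omega>) \<partial>M)
      / (\<integral>\<omega>. exp (\<theta> * arrival_count \<Delta> X t \<omega>) \<partial>M)"

end

theory Submission
  imports Defs
begin

text \<open>
  Put \<open>R = \<theta>\<^sub>t \<phi>\<^sub>t\<^sup>*(t) - \<Lambda>\<^sub>t(\<theta>\<^sub>t)\<close>. The single time point \<open>t\<close> with \<open>\<alpha> = \<theta>\<^sub>t\<close> gives
  \<open>I\<^sub>T(\<phi>) \<ge> R\<close> for every path with \<open>\<phi>(t) = \<phi>\<^sub>t\<^sup>*(t)\<close>. Conversely, Jensen's inequality under the tilted
  measure gives \<open>log E e\<^sup>Y \<ge> E\<^sup>\<theta> Y - R\<close> for every linear combination \<open>Y\<close> of counts, that is,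
  \<open>I\<^sub>T(\<phi>\<^sub>t\<^sup>*) \<le> R\<close>. This needs finite exponential moments of \<open>A(T)\<close>, which come from independence and
  the bounded intensity; by dominated convergence they also make \<open>\<phi>\<^sub>t\<^sup>*\<close> a cadlag path, so that it
  competes in the infimum.
\<close>

section \<open>Preliminaries: nonnegative sums over the integers, and an entropy inequality\<close>

lemma infsum_int_eq_suminf_ennreal:
  fixes h :: "int \<Rightarrow> ennreal"
  shows "infsum h UNIV = (\<Sum>n. h (int_decode n))"
proof -
  have "infsum h UNIV = infsum (\<lambda>n. h (int_decode n)) UNIV"
    by (rule infsum_reindex_bij_betw[symmetric]) (rule bij_int_decode)
  also have "\<dots> = (\<Sum>n. h (int_decode n))"
    by (intro sums_unique has_sum_imp_sums has_sum_infsum nonneg_summable_on_complete) simp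
  finally show ?thesis .
qed

text \<open>The default values match: a divergent real sum is 0, while the same sum in
  \<open>ennreal\<close> is infinite and \<open>enn2real\<close> sends it to 0.\<close>

lemma infsum_eq_enn2real:
  fixes g :: "'i \<Rightarrow> real"
  assumes nonneg: "\<And>k. k \<in> A \<Longrightarrow> 0 \<le> g k"
  shows "infsum g A = enn2real (infsum (\<lambda>k. ennreal (g k)) A)"
proof (cases "g summable_on A")
  case True
  have "ennreal (infsum g A) = infsum (\<lambda>k. ennreal (g k)) A"
  proof -
    have "ennreal (infsum g A) = (SUP F\<in>{F. finite F \<and> F \<subseteq> A}. ennreal (sum g F))"
      by (intro infsum_nonneg_is_SUPREMUM_ennreal True nonneg)
    also have "\<dots> = (SUP F\<in>{F. finite F \<and> F \<subseteq> A}. (\<Sum>k\<in>F. ennreal (g k)))"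
      by (intro SUP_cong refl sum_ennreal[symmetric] nonneg) auto
    also have "\<dots> = infsum (\<lambda>k. ennreal (g k)) A"
      by (rule nonneg_infsum_complete[symmetric]) auto
    finally show ?thesis .
  qed
  then show ?thesis
    by (metis enn2real_ennreal infsum_nonneg nonneg)
next
  case False
  have "infsum (\<lambda>k. ennreal (g k)) A = \<top>"
  proof (rule ccontr)
    assume "infsum (\<lambda>k. ennreal (g k)) A \<noteq> \<top>"
    then obtain B where B: "0 \<le> B" "infsum (\<lambda>k. ennreal (g k)) A = ennreal B"
      by (cases "infsum (\<lambda>k. ennreal (g k)) A") auto
    have "sum g F \<le> B" if F: "F \<subseteq> A" "finite F" for F
    proof -
      have "ennreal (sum g F) = (\<Sum>k\<in>F. ennreal (g k))"
        using F by (intro sum_ennreal[symmetric] nonneg) auto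
      also have "\<dots> \<le> infsum (\<lambda>k. ennreal (g k)) A"
        using F by (subst nonneg_infsum_complete) (auto intro!: SUP_upper)
      finally show ?thesis using B by simp
    qed
    then have "g summable_on A"
      by (intro nonneg_bdd_above_summable_on nonneg bdd_aboveI[of _ B]) auto
    with False show False by simp
  qed
  then show ?thesis using False by (simp add: infsum_not_exists)
qed

text \<open>Passing through \<open>ennreal\<close> writes the sum as a measurable function of a
  series of measurable terms at every \<omega>, including those where the real sum diverges.\<close>

lemma borel_measurable_infsum_int:
  fixes h :: "int \<Rightarrow> 'a \<Rightarrow> real"
  assumes [measurable]: "\<And>k. h k \<in> borel_measurable M" and nonneg: "\<And>k \<omega>. 0 \<le> h k \<omega>"
  shows "(\<lambda>\<omega>. \<Sum>\<^sub>\<infinity>k. h k \<omega>) \<in> borel_measurable M"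
proof -
  have "(\<Sum>\<^sub>\<infinity>k. h k \<omega>) = enn2real (\<Sum>n. ennreal (h (int_decode n) \<omega>))" for \<omega>
    by (simp add: infsum_eq_enn2real nonneg infsum_int_eq_suminf_ennreal)
  then show ?thesis by simp
qed

text \<open>Jensen's inequality under the tilted law with density \<open>e\<^sup>V / E e\<^sup>V\<close>.\<close>

lemma (in prob_space) tilted_expectation_le:
  fixes Y V :: "'a \<Rightarrow> real"
  assumes Y: "integrable M (\<lambda>\<omega>. exp (Y \<omega>))" and V: "integrable M (\<lambda>\<omega>. exp (V \<omega>))"
    and YV: "integrable M (\<lambda>\<omega>. Y \<omega> * exp (V \<omega>))" and VV: "integrable M (\<lambda>\<omega>. V \<omega> * exp (V \<omega>))"
  shows "expectation (\<lambda>\<omega>. Y \<omega> * exp (V \<omega>)) / expectation (\<lambda>\<omega>. exp (V \<omega>)) - ln (expectation (\<lambda>\<omega>. exp (Y \<omega>)))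
    \<le> expectation (\<lambda>\<omega>. V \<omega> * exp (V \<omega>)) / expectation (\<lambda>\<omega>. exp (V \<omega>)) - ln (expectation (\<lambda>\<omega>. exp (V \<omega>)))"
proof -
  define Q where "Q = expectation (\<lambda>\<omega>. exp (Y \<omega>))"
  define Z where "Z = expectation (\<lambda>\<omega>. exp (V \<omega>))"
  have pos: "0 < Q" "0 < Z"
    unfolding Q_def Z_def by (intro expectation_greater Y V; simp)+
  have pointwise: "exp (V \<omega>) + Y \<omega> * exp (V \<omega>) - V \<omega> * exp (V \<omega>) - (ln Q - ln Z) * exp (V \<omega>)
      \<le> Z / Q * exp (Y \<omega>)" for \<omega>
  proof -
    \<comment> \<open>\<open>exp D\<close> is the density of the law tilted by \<open>Y\<close> with
      respect to the law tilted by \<open>V\<close>. Integrating 1 + D <= e^D against e^V therefore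
      says that a relative entropy is nonnegative.\<close>
    define D where "D = Y \<omega> - V \<omega> - (ln Q - ln Z)"
    have "exp (V \<omega>) * (1 + D) \<le> exp (V \<omega>) * exp D"
      by (intro mult_left_mono exp_ge_add_one_self) auto
    also have "exp D = exp (Y \<omega>) / exp (V \<omega>) / (Q / Z)"
      using pos by (simp add: D_def exp_diff)
    also have "exp (V \<omega>) * \<dots> = Z / Q * exp (Y \<omega>)"
      by simp
    finally show ?thesis by (simp add: D_def algebra_simps)
  qed
  have "expectation (\<lambda>\<omega>. exp (V \<omega>) + Y \<omega> * exp (V \<omega>) - V \<omega> * exp (V \<omega>) - (ln Q - ln Z) * exp (V \<omega>))
      \<le> expectation (\<lambda>\<omega>. Z / Q * exp (Y \<omega>))"
    using pointwise by (intro integral_mono) (simp_all add: assms)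
  then have "Z + expectation (\<lambda>\<omega>. Y \<omega> * exp (V \<omega>)) - expectation (\<lambda>\<omega>. V \<omega> * exp (V \<omega>)) - (ln Q - ln Z) * Z \<le> Z / Q * Q"
    by (simp add: assms Q_def[symmetric] Z_def[symmetric])
  then have "expectation (\<lambda>\<omega>. Y \<omega> * exp (V \<omega>)) / Z - expectation (\<lambda>\<omega>. V \<omega> * exp (V \<omega>)) / Z \<le> ln Q - ln Z"
    using pos by (simp add: diff_divide_distrib[symmetric] pos_divide_le_eq)
  then show ?thesis by (simp add: Q_def Z_def)
qed

section \<open>The arrival model and almost sure finiteness of the arrivals in the horizon\<close>

text \<open>Identical distribution is encoded by one density \<open>f\<close> shared by all indices.
  The intensity lives in \<open>ennreal\<close>, so that finiteness of its supremum is a genuine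
  bound and not an artefact of default values.\<close>

locale scheduled_arrivals = prob_space M
  for M :: "'a measure" +
  fixes X :: "int \<Rightarrow> 'a \<Rightarrow> real" and f :: "real \<Rightarrow> real" and \<Delta> T :: real
  assumes horizon_pos: "0 < T"
    and indep: "indep_vars (\<lambda>_. borel) X UNIV"
    and density: "\<And>k. distributed M lborel (X k) (\<lambda>x. ennreal (f x))"
    and bounded_intensity:
      "(SUP u\<in>{0..T}. \<Sum>\<^sub>\<infinity>k::int. ennreal (f (u - of_int k * \<Delta>))) < \<infinity>"
begin

abbreviation \<open>arr \<equiv> arrival_time \<Delta> X\<close>
abbreviation \<open>A \<equiv> arrival_count \<Delta> X\<close>

lemma measurable_arr [measurable]: "arr k \<in> borel_measurable M"
proof -
  have "X k \<in> borel_measurable M"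
    using distributed_measurable[OF density] by simp
  then show ?thesis unfolding arrival_time_def[abs_def] by measurable
qed

lemma measurable_A [measurable]: "A t \<in> borel_measurable M"
  unfolding arrival_count_def[abs_def] by (intro borel_measurable_infsum_int) auto

text \<open>By Tonelli and a shift of variables, the expected number of arrivals in (0,T] is the
  integral of the intensity over that interval, hence at most T times its supremum.\<close>

lemma summable_arrival_probs: "summable (\<lambda>n. prob {\<omega>\<in>space M. arr (int_decode n) \<omega> \<in> {0<..T}})"
proof -
  define C where "C = (SUP u\<in>{0..T}. \<Sum>\<^sub>\<infinity>k::int. ennreal (f (u - of_int k * \<Delta>)))"
  have [measurable]: "(\<lambda>x. ennreal (f x)) \<in> borel_measurable borel"
    using distributed_borel_measurable[OF density] by simp
  have "emeasure M {\<omega>\<in>space M. arr k \<omega> \<in> {0<..T}} =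
      (\<integral>\<^sup>+ u. ennreal (f (u - of_int k * \<Delta>)) * indicator {0<..T} u \<partial>lborel)" for k
  proof -
    have "emeasure M {\<omega>\<in>space M. arr k \<omega> \<in> {0<..T}} = (\<integral>\<^sup>+ \<omega>. indicator {0<..T} (of_int k * \<Delta> + X k \<omega>) \<partial>M)"
      by (subst nn_integral_indicator[symmetric], measurable)
        (auto intro!: nn_integral_cong simp: arrival_time_def split: split_indicator)
    also have "\<dots> = (\<integral>\<^sup>+ x. ennreal (f x) * indicator {0<..T} (of_int k * \<Delta> + x) \<partial>lborel)"
      by (subst distributed_nn_integral[OF density]) auto
    also have "\<dots> = (\<integral>\<^sup>+ u. ennreal (f (u - of_int k * \<Delta>)) * indicator {0<..T} u \<partial>lborel)"
      by (subst nn_integral_real_affine[where c=1 and t="- of_int k * \<Delta>"]) (auto simp: algebra_simps)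
    finally show ?thesis .
  qed
  then have "(\<Sum>n. emeasure M {\<omega>\<in>space M. arr (int_decode n) \<omega> \<in> {0<..T}}) =
      (\<Sum>n. \<integral>\<^sup>+ u. ennreal (f (u - of_int (int_decode n) * \<Delta>)) * indicator {0<..T} u \<partial>lborel)"
    by simp
  also have "\<dots> = (\<integral>\<^sup>+ u. (\<Sum>n. ennreal (f (u - of_int (int_decode n) * \<Delta>)) * indicator {0<..T} u) \<partial>lborel)"
    by (intro nn_integral_suminf[symmetric]) measurable
  also have "\<dots> \<le> (\<integral>\<^sup>+ u. C * indicator {0<..T} u \<partial>lborel)"
  proof (intro nn_integral_mono)
    fix u
    have "(\<Sum>n. ennreal (f (u - of_int (int_decode n) * \<Delta>))) \<le> C" if "u \<in> {0<..T}"
      unfolding C_def infsum_int_eq_suminf_ennreal using that by (intro SUP_upper) auto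
    then show "(\<Sum>n. ennreal (f (u - of_int (int_decode n) * \<Delta>)) * indicator {0<..T} u) \<le> C * indicator {0<..T} u"
      by (auto split: split_indicator)
  qed
  also have "\<dots> = C * ennreal T"
    using horizon_pos by (simp add: nn_integral_cmult_indicator)
  also have "\<dots> < \<infinity>"
    using bounded_intensity by (simp add: C_def[symmetric] ennreal_mult_less_top)
  finally show ?thesis
    by (intro summable_suminf_not_top) (simp_all add: emeasure_eq_measure)
qed

text \<open>First Borel-Cantelli lemma. The pathwise arguments below all run on this event, where
  every count up to T is a finite sum.\<close>

lemma AE_finite_arrivals: "AE \<omega> in M. finite {k. arr k \<omega> \<in> {0<..T}}"
proof -
  have "AE \<omega> in M. \<forall>\<^sub>F n in sequentially. \<omega> \<in> space M - {\<omega>\<in>space M. arr (int_decode n) \<omega> \<in> {0<..T}}"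
    by (intro borel_cantelli_AE1 summable_arrival_probs) (auto simp: less_top[symmetric])
  then show ?thesis
  proof eventually_elim
    case (elim \<omega>)
    \<comment> \<open>On the naturals, eventually means outside a finite set; surjectivity of
      \<open>int_decode\<close> then carries finiteness over to the integer indices.\<close>
    then have "\<forall>\<^sub>F n in cofinite. \<not> arr (int_decode n) \<omega> \<in> {0<..T}"
      by (auto simp: cofinite_eq_sequentially elim!: eventually_mono)
    then have "finite {n. arr (int_decode n) \<omega> \<in> {0<..T}}"
      by (simp add: eventually_cofinite)
    then have "finite (int_decode ` {n. arr (int_decode n) \<omega> \<in> {0<..T}})"
      by simp
    then show ?case
      by (rule rev_finite_subset) (auto simp: image_iff intro!: exI[of _ "int_encode _"])
  qed
qed

section \<open>Counts as finite sums, and their exponential moments\<close>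

text \<open>
  The function \<open>g\<close> covers both the counts themselves and, as indicator of \<open>(0, u)\<close>, their left limits.
\<close>

lemma infsum_arrivals_eq_sum:
  fixes g :: "real \<Rightarrow> real"
  assumes "\<And>x. x \<notin> {0<..T} \<Longrightarrow> g x = 0" and "finite {k. arr k \<omega> \<in> {0<..T}}"
  shows "(\<Sum>\<^sub>\<infinity>k. g (arr k \<omega>)) = (\<Sum>k | arr k \<omega> \<in> {0<..T}. g (arr k \<omega>))"
proof -
  have "(\<Sum>\<^sub>\<infinity>k. g (arr k \<omega>)) = (\<Sum>\<^sub>\<infinity>k\<in>{k. arr k \<omega> \<in> {0<..T}}. g (arr k \<omega>))"
    using assms(1) by (intro infsum_cong_neutral) auto
  with assms(2) show ?thesis by simp
qed

text \<open>The index set depends on T but not on u, so counts at different times can be compared,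
  and limits in u taken, term by term.\<close>

lemma A_eq_sum:
  assumes "u \<le> T" "finite {k. arr k \<omega> \<in> {0<..T}}"
  shows "A u \<omega> = (\<Sum>k | arr k \<omega> \<in> {0<..T}. indicator {0<..u} (arr k \<omega>))"
  unfolding arrival_count_def using assms by (intro infsum_arrivals_eq_sum) (auto split: split_indicator)

lemma A_nonneg: "0 \<le> A u \<omega>"
  unfolding arrival_count_def by (intro infsum_nonneg) auto

lemma A_mono:
  assumes "u \<le> T" "finite {k. arr k \<omega> \<in> {0<..T}}"
  shows "A u \<omega> \<le> A T \<omega>"
  using assms(1) by (simp only: A_eq_sum[OF assms] A_eq_sum[OF order.refl assms(2)])
    (intro sum_mono, auto split: split_indicator)

text \<open>
  Fatou along the partial sums; independence bounds their moment generating functions by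
  \<open>\<Prod>(1 + (e\<^sup>s - 1) p\<^sub>k) \<le> exp ((e\<^sup>s - 1) \<Sum>p\<^sub>k)\<close>.
\<close>

lemma integrable_exp_A_horizon:
  assumes s: "0 \<le> s"
  shows "integrable M (\<lambda>\<omega>. exp (s * A T \<omega>))"
proof (rule integrableI_bounded)
  define p where "p n = prob {\<omega>\<in>space M. arr (int_decode n) \<omega> \<in> {0<..T}}" for n
  define B where "B n \<omega> = (indicator {0<..T} (arr (int_decode n) \<omega>) :: real)" for n \<omega>
  have [measurable]: "B n \<in> borel_measurable M" for n
    unfolding B_def[abs_def] by measurable
  have partial: "(\<integral>\<^sup>+ \<omega>. ennreal (exp (s * (\<Sum>i<n. B i \<omega>))) \<partial>M) \<le> ennreal (exp ((exp s - 1) * suminf p))" for n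
  proof -
    \<comment> \<open>Each factor is written as a function of \<open>X k\<close> alone, so that
      independence of the displacements passes to the factors.\<close>
    define g where "g k x = ennreal (exp (s * indicator {0<..T} (of_int k * \<Delta> + x)))" for k :: int and x
    have factor: "(\<integral>\<^sup>+ \<omega>. g (int_decode i) (X (int_decode i) \<omega>) \<partial>M) \<le> ennreal (exp ((exp s - 1) * p i))" for i
    proof -
      have "(\<integral>\<^sup>+ \<omega>. g (int_decode i) (X (int_decode i) \<omega>) \<partial>M) =
          (\<integral>\<^sup>+ \<omega>. 1 + ennreal (exp s - 1) * indicator {\<omega>\<in>space M. arr (int_decode i) \<omega> \<in> {0<..T}} \<omega> \<partial>M)"
      proof (rule nn_integral_cong)
        \<comment> \<open>\<open>ennreal\<close> truncates negative numbers to 0, so this splitting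
          relies on s >= 0.\<close>
        have "ennreal (exp s) = 1 + ennreal (exp s - 1)"
          using s by (subst ennreal_1[symmetric], subst ennreal_plus[symmetric]) auto
        then show "g (int_decode i) (X (int_decode i) \<omega>) =
            1 + ennreal (exp s - 1) * indicator {\<omega>\<in>space M. arr (int_decode i) \<omega> \<in> {0<..T}} \<omega>"
          if "\<omega> \<in> space M" for \<omega>
          using that by (auto simp: g_def arrival_time_def split: split_indicator)
      qed
      also have "\<dots> = 1 + ennreal (exp s - 1) * ennreal (p i)"
        by (subst nn_integral_add) (auto simp: nn_integral_cmult_indicator emeasure_eq_measure p_def prob_space)
      also have "\<dots> = ennreal (1 + (exp s - 1) * p i)"
        using s by (simp add: p_def ennreal_mult[symmetric] ennreal_plus[symmetric] ennreal_1[symmetric] del: ennreal_plus ennreal_1)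
      also have "\<dots> \<le> ennreal (exp ((exp s - 1) * p i))"
        by (intro ennreal_leI) (rule exp_ge_add_one_self)
      finally show ?thesis .
    qed
    have inj: "inj_on int_decode {..<n}"
      by (rule inj_int_decode)
    have "indep_vars (\<lambda>_. borel) (\<lambda>k \<omega>. g k (X k \<omega>)) (int_decode ` {..<n})"
      by (rule indep_vars_compose2[OF indep_vars_subset[OF indep]]) (auto simp: g_def[abs_def])
    then have "(\<integral>\<^sup>+ \<omega>. (\<Prod>k\<in>int_decode ` {..<n}. g k (X k \<omega>)) \<partial>M) =
        (\<Prod>k\<in>int_decode ` {..<n}. \<integral>\<^sup>+ \<omega>. g k (X k \<omega>) \<partial>M)"
      by (intro indep_vars_nn_integral) auto
    moreover have "(\<Prod>k\<in>int_decode ` {..<n}. g k (X k \<omega>)) = ennreal (exp (s * (\<Sum>i<n. B i \<omega>)))" for \<omega>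
    proof -
      have "(\<Prod>k\<in>int_decode ` {..<n}. g k (X k \<omega>)) = (\<Prod>i<n. ennreal (exp (s * B i \<omega>)))"
        by (simp add: prod.reindex[OF inj] g_def B_def arrival_time_def)
      then show ?thesis
        by (simp add: prod_ennreal exp_sum sum_distrib_left)
    qed
    ultimately have "(\<integral>\<^sup>+ \<omega>. ennreal (exp (s * (\<Sum>i<n. B i \<omega>))) \<partial>M) =
        (\<Prod>i<n. \<integral>\<^sup>+ \<omega>. g (int_decode i) (X (int_decode i) \<omega>) \<partial>M)"
      by (simp add: prod.reindex[OF inj])
    also have "\<dots> \<le> (\<Prod>i<n. ennreal (exp ((exp s - 1) * p i)))"
      by (intro prod_mono_ennreal factor)
    also have "\<dots> = ennreal (exp ((exp s - 1) * (\<Sum>i<n. p i)))"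
      by (simp add: prod_ennreal exp_sum sum_distrib_left)
    also have "\<dots> \<le> ennreal (exp ((exp s - 1) * suminf p))"
      using s summable_arrival_probs
      by (intro ennreal_leI iffD2[OF exp_le_cancel_iff] mult_left_mono sum_le_suminf) (auto simp: p_def)
    finally show ?thesis .
  qed
  \<comment> \<open>With finitely many arrivals the partial sums are eventually constant, so the
    lower limit is the true limit.\<close>
  have "AE \<omega> in M. ennreal (norm (exp (s * A T \<omega>))) = liminf (\<lambda>n. ennreal (exp (s * (\<Sum>i<n. B i \<omega>))))"
    using AE_finite_arrivals
  proof eventually_elim
    case (elim \<omega>)
    have "finite {n. arr (int_decode n) \<omega> \<in> {0<..T}}"
      using finite_vimageI[OF elim inj_int_decode] by (simp add: vimage_def)
    then have "(\<lambda>n. B n \<omega>) sums (\<Sum>n | arr (int_decode n) \<omega> \<in> {0<..T}. B n \<omega>)"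
      by (intro sums_finite) (auto simp: B_def)
    moreover have "(\<Sum>n | arr (int_decode n) \<omega> \<in> {0<..T}. B n \<omega>) = A T \<omega>"
    proof -
      have "(\<Sum>n | arr (int_decode n) \<omega> \<in> {0<..T}. B n \<omega>) = (\<Sum>k | arr k \<omega> \<in> {0<..T}. indicator {0<..T} (arr k \<omega>))"
        unfolding B_def by (rule sum.reindex_bij_witness[of _ int_encode int_decode]) auto
      then show ?thesis using elim by (simp add: A_eq_sum)
    qed
    ultimately have "(\<lambda>n. ennreal (exp (s * (\<Sum>i<n. B i \<omega>)))) \<longlonglongrightarrow> ennreal (norm (exp (s * A T \<omega>)))"
      unfolding sums_def by (auto intro!: tendsto_intros)
    then show ?case
      by (intro lim_imp_Liminf[symmetric]) auto
  qed
  then have "(\<integral>\<^sup>+ \<omega>. ennreal (norm (exp (s * A T \<omega>))) \<partial>M) =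
      (\<integral>\<^sup>+ \<omega>. liminf (\<lambda>n. ennreal (exp (s * (\<Sum>i<n. B i \<omega>)))) \<partial>M)"
    by (rule nn_integral_cong_AE)
  also have "\<dots> \<le> liminf (\<lambda>n. \<integral>\<^sup>+ \<omega>. ennreal (exp (s * (\<Sum>i<n. B i \<omega>))) \<partial>M)"
    by (rule nn_integral_liminf) measurable
  also have "\<dots> \<le> ennreal (exp ((exp s - 1) * suminf p))"
    using partial by (intro Liminf_le) auto
  also have "\<dots> < \<infinity>" by simp
  finally show "(\<integral>\<^sup>+ \<omega>. ennreal (norm (exp (s * A T \<omega>))) \<partial>M) < \<infinity>" .
qed measurable

text \<open>Almost surely 0 <= A(u) <= A(T) for u <= T, so the exponent is at most A(T) times the
  sum of the absolute values of the coefficients.\<close>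

lemma integrable_exp_sum_A:
  assumes "\<And>l. l \<in> L \<Longrightarrow> \<tau> l \<le> T"
  shows "integrable M (\<lambda>\<omega>. exp (\<Sum>l\<in>L. \<alpha> l * A (\<tau> l) \<omega>))"
proof (rule Bochner_Integration.integrable_bound[OF integrable_exp_A_horizon])
  show "0 \<le> (\<Sum>l\<in>L. \<bar>\<alpha> l\<bar>)" by (simp add: sum_nonneg)
  show "AE \<omega> in M. norm (exp (\<Sum>l\<in>L. \<alpha> l * A (\<tau> l) \<omega>)) \<le> norm (exp ((\<Sum>l\<in>L. \<bar>\<alpha> l\<bar>) * A T \<omega>))"
    using AE_finite_arrivals
  proof eventually_elim
    case (elim \<omega>)
    have "\<alpha> l * A (\<tau> l) \<omega> \<le> \<bar>\<alpha> l\<bar> * A T \<omega>" if "l \<in> L" for l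
      using that assms by (intro mult_mono A_mono[OF _ elim] A_nonneg) auto
    then show ?case by (auto simp: sum_distrib_right intro!: sum_mono)
  qed
qed measurable

lemma integrable_exp_A:
  assumes "t \<le> T"
  shows "integrable M (\<lambda>\<omega>. exp (\<theta> * A t \<omega>))"
  using integrable_exp_sum_A[of "{0::nat}" "\<lambda>_. t" "\<lambda>_. \<theta>"] assms by simp

text \<open>The linear factor is absorbed by x <= e^x, which accounts for the 1 in the exponent. The
  bound does not involve u, so it also dominates along sequences of times.\<close>

lemma tilted_count_le:
  assumes "u \<le> T" "t \<le> T" "finite {k. arr k \<omega> \<in> {0<..T}}"
  shows "A u \<omega> * exp (\<theta> * A t \<omega>) \<le> exp ((1 + \<bar>\<theta>\<bar>) * A T \<omega>)"
proof -
  have "A u \<omega> \<le> exp (A T \<omega>)"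
    using A_mono[OF assms(1,3)] exp_ge_add_one_self[of "A T \<omega>"] by linarith
  moreover have "\<theta> * A t \<omega> \<le> \<bar>\<theta>\<bar> * A T \<omega>"
    by (intro mult_mono A_mono assms A_nonneg) auto
  ultimately have "A u \<omega> * exp (\<theta> * A t \<omega>) \<le> exp (A T \<omega>) * exp (\<bar>\<theta>\<bar> * A T \<omega>)"
    by (intro mult_mono) auto
  then show ?thesis by (simp add: exp_add[symmetric] algebra_simps)
qed

lemma integrable_tilted_count:
  assumes "u \<le> T" "t \<le> T"
  shows "integrable M (\<lambda>\<omega>. A u \<omega> * exp (\<theta> * A t \<omega>))"
proof (rule Bochner_Integration.integrable_bound[OF integrable_exp_A_horizon[of "1 + \<bar>\<theta>\<bar>"]])
  show "AE \<omega> in M. norm (A u \<omega> * exp (\<theta> * A t \<omega>)) \<le> norm (exp ((1 + \<bar>\<theta>\<bar>) * A T \<omega>))"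
    using AE_finite_arrivals by eventually_elim (simp add: abs_mult A_nonneg tilted_count_le assms)
qed auto

lemma exp_A_expectation_pos:
  assumes "t \<le> T"
  shows "0 < expectation (\<lambda>\<omega>. exp (\<theta> * A t \<omega>))"
  by (intro expectation_greater integrable_exp_A assms) auto

section \<open>Regularity of the mean path\<close>

text \<open>One dominated convergence argument serves both one-sided limits: \<open>S\<close> is the
  side from which v approaches u, and \<open>g\<close> is the pointwise limit of the indicators of
  (0,v]. Almost surely finitely many arrivals contribute, so this limit passes through the
  sum.\<close>

lemma tendsto_mean_path:
  fixes g :: "real \<Rightarrow> real"
  assumes t: "t \<le> T" and S: "S \<subseteq> {0..T}"
    and g [measurable]: "g \<in> borel_measurable borel" and g_nonneg: "\<And>x. 0 \<le> g x"
    and g_zero: "\<And>x. x \<notin> {0<..T} \<Longrightarrow> g x = 0"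
    and lim: "\<And>x. ((\<lambda>v. indicator {0<..v} x) \<longlongrightarrow> g x) (at u within S)"
  shows "(mean_path M \<Delta> X t \<theta> \<longlongrightarrow>
    expectation (\<lambda>\<omega>. (\<Sum>\<^sub>\<infinity>k. g (arr k \<omega>)) * exp (\<theta> * A t \<omega>)) / expectation (\<lambda>\<omega>. exp (\<theta> * A t \<omega>)))
    (at u within S)"
  unfolding mean_path_def
proof (intro tendsto_divide tendsto_const)
  show "expectation (\<lambda>\<omega>. exp (\<theta> * A t \<omega>)) \<noteq> 0"
    using exp_A_expectation_pos[OF t, of \<theta>] by simp
  show "((\<lambda>v. expectation (\<lambda>\<omega>. A v \<omega> * exp (\<theta> * A t \<omega>))) \<longlongrightarrow>
      expectation (\<lambda>\<omega>. (\<Sum>\<^sub>\<infinity>k. g (arr k \<omega>)) * exp (\<theta> * A t \<omega>))) (at u within S)"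
    \<comment> \<open>Dominated convergence is applied along sequences, so the filter limit is first
      reduced to sequential ones.\<close>
    unfolding tendsto_at_iff_sequentially comp_def
  proof (intro allI impI)
    fix v :: "nat \<Rightarrow> real"
    assume v: "\<forall>i. v i \<in> S - {u}" "v \<longlonglongrightarrow> u"
    then have vT: "v i \<le> T" for i using S by auto
    show "(\<lambda>i. expectation (\<lambda>\<omega>. A (v i) \<omega> * exp (\<theta> * A t \<omega>))) \<longlonglongrightarrow>
        expectation (\<lambda>\<omega>. (\<Sum>\<^sub>\<infinity>k. g (arr k \<omega>)) * exp (\<theta> * A t \<omega>))"
    proof (rule integral_dominated_convergence)
      have "(\<lambda>\<omega>. \<Sum>\<^sub>\<infinity>k. g (arr k \<omega>)) \<in> borel_measurable M"
        by (intro borel_measurable_infsum_int g_nonneg) measurable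
      then show "(\<lambda>\<omega>. (\<Sum>\<^sub>\<infinity>k. g (arr k \<omega>)) * exp (\<theta> * A t \<omega>)) \<in> borel_measurable M"
        by measurable
      show "integrable M (\<lambda>\<omega>. exp ((1 + \<bar>\<theta>\<bar>) * A T \<omega>))"
        by (intro integrable_exp_A_horizon) simp
      show "AE \<omega> in M. norm (A (v i) \<omega> * exp (\<theta> * A t \<omega>)) \<le> exp ((1 + \<bar>\<theta>\<bar>) * A T \<omega>)" for i
        using AE_finite_arrivals
        by eventually_elim (simp add: abs_mult A_nonneg tilted_count_le vT t)
      show "AE \<omega> in M. (\<lambda>i. A (v i) \<omega> * exp (\<theta> * A t \<omega>)) \<longlonglongrightarrow> (\<Sum>\<^sub>\<infinity>k. g (arr k \<omega>)) * exp (\<theta> * A t \<omega>)"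
        using AE_finite_arrivals
      proof eventually_elim
        case (elim \<omega>)
        have "(\<lambda>i. indicator {0<..v i} x) \<longlonglongrightarrow> g x" for x
          using lim[of x] v unfolding tendsto_at_iff_sequentially comp_def by blast
        moreover have "(\<Sum>\<^sub>\<infinity>k. g (arr k \<omega>)) = (\<Sum>k | arr k \<omega> \<in> {0<..T}. g (arr k \<omega>))"
          using g_zero elim by (rule infsum_arrivals_eq_sum)
        ultimately show ?case
          by (auto simp only: A_eq_sum[OF vT elim] intro!: tendsto_mult tendsto_sum tendsto_const)
      qed
    qed measurable
  qed
qed

lemma mean_path_cadlag:
  assumes t: "t \<le> T"
  shows "mean_path M \<Delta> X t \<theta> \<in> cadlag_paths T"
  unfolding cadlag_paths_def
proof (intro CollectI ballI conjI)
  fix u assume u: "u \<in> {0..T}"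
  \<comment> \<open>For fixed x the indicator is eventually constant: if x <= u, every v >= u gives
    the same value, and if x > u, then v < x near u.\<close>
  have "((\<lambda>v. indicator {0<..v} x :: real) \<longlongrightarrow> indicator {0<..u} x) (at u within {u..T})" for x
  proof (rule tendsto_eventually)
    show "\<forall>\<^sub>F v in at u within {u..T}. indicator {0<..v} x = (indicator {0<..u} x :: real)"
    proof (cases "x \<le> u")
      case True
      then show ?thesis
        by (auto simp: eventually_at_filter split: split_indicator)
    next
      case False
      then have "\<forall>\<^sub>F v in at u within {u..T}. v < x"
        by (intro order_tendstoD(2)[OF tendsto_ident_at]) simp
      then show ?thesis
        by (rule eventually_mono) (use False in \<open>auto split: split_indicator\<close>)
    qed
  qed
  then have "(mean_path M \<Delta> X t \<theta> \<longlongrightarrow>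
      expectation (\<lambda>\<omega>. (\<Sum>\<^sub>\<infinity>k. indicator {0<..u} (arr k \<omega>)) * exp (\<theta> * A t \<omega>)) / expectation (\<lambda>\<omega>. exp (\<theta> * A t \<omega>)))
      (at u within {u..T})"
    using u by (intro tendsto_mean_path[OF t, where g="indicator {0<..u}"]) (auto split: split_indicator)
  then show "(mean_path M \<Delta> X t \<theta> \<longlongrightarrow> mean_path M \<Delta> X t \<theta> u) (at u within {u..T})"
    by (simp add: mean_path_def arrival_count_def)
  \<comment> \<open>An arrival exactly at u is missed by every v < u, hence the open interval. For u
    = 0 the filter is trivial.\<close>
  have left: "((\<lambda>v. indicator {0<..v} x :: real) \<longlongrightarrow> indicator {0<..<u} x) (at u within {0..<u})" for x
  proof (rule tendsto_eventually)
    show "\<forall>\<^sub>F v in at u within {0..<u}. indicator {0<..v} x = (indicator {0<..<u} x :: real)"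
    proof (cases "x < u")
      case True
      then have "\<forall>\<^sub>F v in at u within {0..<u}. x < v"
        by (intro order_tendstoD(1)[OF tendsto_ident_at]) simp
      then show ?thesis
        by (rule eventually_mono) (use True in \<open>auto split: split_indicator\<close>)
    next
      case False
      then show ?thesis
        by (auto simp: eventually_at_filter split: split_indicator)
    qed
  qed
  show "\<exists>l. (mean_path M \<Delta> X t \<theta> \<longlongrightarrow> l) (at u within {0..<u})"
    by (rule exI, rule tendsto_mean_path[OF t, where g="indicator {0<..<u}"])
      (use u left t in \<open>auto split: split_indicator\<close>)
qed

section \<open>Upper and lower bounds for the path rate\<close>

text \<open>The mean path records tilted means, so by linearity the two tilted expectations in
  \<open>tilted_expectation_le\<close> are the linear functional of the mean path and \<theta> times
  its value at t. The resulting bound is the same for all times and coefficients.\<close>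

lemma path_rate_mean_path_le:
  assumes t: "t \<le> T"
  shows "path_rate M \<Delta> X T (mean_path M \<Delta> X t \<theta>)
    \<le> ereal (\<theta> * mean_path M \<Delta> X t \<theta> t - log_mgf M (\<lambda>\<omega>. \<theta> * A t \<omega>))"
  unfolding path_rate_def
proof (intro SUP_least)
  fix m :: nat and \<tau> \<alpha> :: "nat \<Rightarrow> real"
  assume m: "m \<in> {1..}" and \<tau>: "\<tau> \<in> {\<tau>. strict_mono_on {1..m} \<tau> \<and> 0 < \<tau> 1 \<and> \<tau> m \<le> T}"
  have \<tau>T: "\<tau> l \<le> T" if "l \<in> {1..m}" for l
  proof -
    have "\<tau> l \<le> \<tau> m"
      using \<tau> that m by (auto intro!: strict_mono_on_leD[of "{1..m}" \<tau>])
    with \<tau> show ?thesis by auto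
  qed
  let ?Y = "\<lambda>\<omega>. \<Sum>l=1..m. \<alpha> l * A (\<tau> l) \<omega>" and ?V = "\<lambda>\<omega>. \<theta> * A t \<omega>"
  have split: "?Y \<omega> * exp (?V \<omega>) = (\<Sum>l=1..m. \<alpha> l * (A (\<tau> l) \<omega> * exp (?V \<omega>)))" for \<omega>
    by (simp add: sum_distrib_right mult.assoc)
  have int: "integrable M (\<lambda>\<omega>. \<alpha> l * (A (\<tau> l) \<omega> * exp (?V \<omega>)))" if "l \<in> {1..m}" for l
    by (intro integrable_mult_right integrable_tilted_count \<tau>T that t)
  have "expectation (\<lambda>\<omega>. ?Y \<omega> * exp (?V \<omega>)) / expectation (\<lambda>\<omega>. exp (?V \<omega>)) - ln (expectation (\<lambda>\<omega>. exp (?Y \<omega>)))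
    \<le> expectation (\<lambda>\<omega>. ?V \<omega> * exp (?V \<omega>)) / expectation (\<lambda>\<omega>. exp (?V \<omega>)) - ln (expectation (\<lambda>\<omega>. exp (?V \<omega>)))"
  proof (rule tilted_expectation_le)
    show "integrable M (\<lambda>\<omega>. exp (?Y \<omega>))"
      by (rule integrable_exp_sum_A) (rule \<tau>T)
    show "integrable M (\<lambda>\<omega>. exp (?V \<omega>))"
      by (rule integrable_exp_A[OF t])
    show "integrable M (\<lambda>\<omega>. ?Y \<omega> * exp (?V \<omega>))"
      unfolding split by (intro Bochner_Integration.integrable_sum int)
    show "integrable M (\<lambda>\<omega>. ?V \<omega> * exp (?V \<omega>))"
      unfolding mult.assoc by (intro integrable_mult_right integrable_tilted_count t)
  qed
  moreover have "expectation (\<lambda>\<omega>. ?Y \<omega> * exp (?V \<omega>)) / expectation (\<lambda>\<omega>. exp (?V \<omega>)) =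
      (\<Sum>l=1..m. \<alpha> l * mean_path M \<Delta> X t \<theta> (\<tau> l))"
    unfolding split using int
    by (subst Bochner_Integration.integral_sum) (auto simp: mean_path_def sum_divide_distrib)
  moreover have "expectation (\<lambda>\<omega>. ?V \<omega> * exp (?V \<omega>)) / expectation (\<lambda>\<omega>. exp (?V \<omega>)) =
      \<theta> * mean_path M \<Delta> X t \<theta> t"
    by (simp add: mean_path_def mult.assoc)
  ultimately show "ereal ((\<Sum>l=1..m. \<alpha> l * mean_path M \<Delta> X t \<theta> (\<tau> l)) - log_mgf M ?Y)
      \<le> ereal (\<theta> * mean_path M \<Delta> X t \<theta> t - log_mgf M ?V)"
    by (simp add: log_mgf_def)
qed

end

lemma path_rate_ge_marginal_legendre:
  assumes "t \<in> {0<..T}"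
  shows "ereal (\<theta> * \<phi> t - log_mgf M (\<lambda>\<omega>. \<theta> * arrival_count \<Delta> X t \<omega>)) \<le> path_rate M \<Delta> X T \<phi>"
  unfolding path_rate_def
\<comment> \<open>Strict monotonicity is trivial on a one-point index set, so constant functions can
  serve as the time and coefficient vectors.\<close>
proof (rule SUP_upper2[where i=1], simp, rule SUP_upper2[where i="\<lambda>_. t"])
  show "(\<lambda>_. t) \<in> {\<tau>::nat \<Rightarrow> real. strict_mono_on {1..1} \<tau> \<and> 0 < \<tau> 1 \<and> \<tau> 1 \<le> T}"
    using assms by (auto simp: strict_mono_on_def)
qed (auto intro!: SUP_upper2[where i="\<lambda>_. \<theta>"])

theorem proposition7p1:
  fixes M :: "'a measure" and X :: "int \<Rightarrow> 'a \<Rightarrow> real" and f :: "real \<Rightarrow> real"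
    and \<Delta> T a c :: real
  assumes "prob_space M"
    and "0 < \<Delta>" and "0 < T"
    and "prob_space.indep_vars M (\<lambda>_. borel) X UNIV"
    and "\<And>x. 0 \<le> f x"
    and "\<And>k. distributed M lborel (X k) (\<lambda>x. ennreal (f x))"
    and "(SUP u\<in>{0..T}. \<Sum>\<^sub>\<infinity>k::int. ennreal (f (u - of_int k * \<Delta>))) < \<infinity>"
    and "0 < a" and "0 < c"
  shows "\<forall>t\<in>{0<..T}. \<forall>\<theta>::real.
    ((\<lambda>s. log_mgf M (\<lambda>\<omega>. s * arrival_count \<Delta> X t \<omega>)) has_real_derivative (a + c * t)) (at \<theta>) \<longrightarrow>
    path_rate M \<Delta> X T (mean_path M \<Delta> X t \<theta>)
      = marginal_rate M \<Delta> X T t (mean_path M \<Delta> X t \<theta> t)"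
proof (intro ballI allI impI antisym)
  interpret scheduled_arrivals M X f \<Delta> T
    unfolding scheduled_arrivals_def scheduled_arrivals_axioms_def using assms by blast
  fix t \<theta> assume t: "t \<in> {0<..T}"
  let ?\<phi> = "mean_path M \<Delta> X t \<theta>"
  show "marginal_rate M \<Delta> X T t (?\<phi> t) \<le> path_rate M \<Delta> X T ?\<phi>"
    unfolding marginal_rate_def using t by (intro INF_lower) (auto intro!: mean_path_cadlag)
  have "path_rate M \<Delta> X T ?\<phi> \<le> ereal (\<theta> * ?\<phi> t - log_mgf M (\<lambda>\<omega>. \<theta> * arrival_count \<Delta> X t \<omega>))"
    using t by (intro path_rate_mean_path_le) simp
  \<comment> \<open>The middle quantity depends on a path only through its value at t, which all
    competitors share.\<close>
  also have "\<dots> \<le> marginal_rate M \<Delta> X T t (?\<phi> t)"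
    unfolding marginal_rate_def
  proof (intro INF_greatest)
    fix \<psi> assume "\<psi> \<in> {\<psi> \<in> cadlag_paths T. \<psi> t = ?\<phi> t}"
    then show "ereal (\<theta> * ?\<phi> t - log_mgf M (\<lambda>\<omega>. \<theta> * arrival_count \<Delta> X t \<omega>)) \<le> path_rate M \<Delta> X T \<psi>"
      using path_rate_ge_marginal_legendre[OF t, of \<theta> \<psi> M \<Delta> X] by simp
  qed
  finally show "path_rate M \<Delta> X T ?\<phi> \<le> marginal_rate M \<Delta> X T t (?\<phi> t)" .
qed

end
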